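(* (i) Let $\mathcal A$ be a tolerance factorable algebra and let $T\in\mathrm{Tol}(\mathcal A)$. Then there exist an algebra $\mathcal B$ of the same type as $\mathcal A$, a congruence $\theta$ of $\mathcal B$, and a surjective homomorphism $\varphi\colon\mathcal B\to\mathcal A$ such that $T=\varphi(\theta)$, where $\varphi(\theta)=\{(\varphi(x),\varphi(y)):(x,y)\in\theta\}$. (ii) If a variety is strongly tolerance factorable, then its tolerances are the images of its congruences.
   Context: Tolerances and blocks. A tolerance on an algebra $\mathcal A=(A,F)$ is a reflexive, symmetric relation $T\subseteq A^2$ compatible with all operations in $F$; $\mathrm{Tol}(\mathcal A)$ is the set of all tolerances of $\mathcal A$. A block of $T$ is a maximal subset $B\subseteq A$ such that $B^2\subseteq T$; $\mathrm{Block}(T)$ is the set of all blocks of $T$. For every $n$-ary $f\in F$ and $B_1,\dots,B_n\in\mathrm{Block}(T)$ there is at least one $B\in\mathrm{Block}(T)$ with $\{f(b_1,\dots,b_n): b_1\in B_1,\dots,b_n\in B_n\}\subseteq B$. The algebra $\mathcal A$ is $T$-factorable if, for each $n$, each $n$-ary $f\in F$ and all $B_1,\dots,B_n\in\mathrm{Block}(T)$, this block $B$ is uniquely determined; in this case $f(B_1,\dots,B_n):=B$ defines the quotient algebra $\mathcal A/T=(\mathrm{Block}(T),F)$. The algebra $\mathcal A$ is tolerance factorable if it is $T$-factorable for all $T\in\mathrm{Tol}(\mathcal A)$. Properties of a variety $\mathcal W$. - $\mathcal W$ is tolerance factorable if all of its members are tolerance factorable. - $\mathcal W$ is strongly tolerance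 factorable if it is tolerance factorable and $\mathcal A/T\in\mathcal W$ for all $\mathcal A\in\mathcal W$ and all $T\in\mathrm{Tol}(\mathcal A)$. - The tolerances of $\mathcal W$ are the images of its congruences if for each $\mathcal A\in\mathcal W$ and every $T\in\mathrm{Tol}(\mathcal A)$ there exist an algebra $\mathcal B\in\mathcal W$, a congruence $\theta$ of $\mathcal B$ and a surjective homomorphism $\varphi\colon\mathcal B\to\mathcal A$ such that $T=\{(\varphi(a),\varphi(b)):(a,b)\in\theta\}$. *)

theory Defs
  imports Main
begin

text \<open>Similarity types carry an explicit set of operation symbols, so that the empty similarity
  type is included. An operation takes its arguments as a list; its values are only relevant for
  symbols of the similarity type and for lists over the carrier of the correct length.\<close>

record 'f signature =
  symbols :: "'f set"
  arity :: "'f \<Rightarrow> nat"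

record ('f, 'a) algebra =
  carrier :: "'a set"
  oper :: "'f \<Rightarrow> 'a list \<Rightarrow> 'a"

definition args :: "'f signature \<Rightarrow> 'f \<Rightarrow> 'a set \<Rightarrow> 'a list set" where
  "args S f X = {xs. length xs = arity S f \<and> set xs \<subseteq> X}"

definition algebra :: "'f signature \<Rightarrow> ('f, 'a) algebra \<Rightarrow> bool" where
  "algebra S A \<longleftrightarrow> carrier A \<noteq> {} \<and>
     (\<forall>f\<in>symbols S. \<forall>xs\<in>args S f (carrier A). oper A f xs \<in> carrier A)"

definition compatible :: "'f signature \<Rightarrow> ('f, 'a) algebra \<Rightarrow> ('a \<times> 'a) set \<Rightarrow> bool" where
  "compatible S A R \<longleftrightarrow>
     (\<forall>f\<in>symbols S. \<forall>xs\<in>args S f (carrier A). \<forall>ys\<in>args S f (carrier A).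
        list_all2 (\<lambda>x y. (x, y) \<in> R) xs ys \<longrightarrow> (oper A f xs, oper A f ys) \<in> R)"

definition tolerance :: "'f signature \<Rightarrow> ('f, 'a) algebra \<Rightarrow> ('a \<times> 'a) set \<Rightarrow> bool" where
  "tolerance S A T \<longleftrightarrow>
     T \<subseteq> carrier A \<times> carrier A \<and> refl_on (carrier A) T \<and> sym T \<and> compatible S A T"

definition congruence :: "'f signature \<Rightarrow> ('f, 'a) algebra \<Rightarrow> ('a \<times> 'a) set \<Rightarrow> bool" where
  "congruence S A \<theta> \<longleftrightarrow> equiv (carrier A) \<theta> \<and> compatible S A \<theta>"

definition homomorphism ::
    "'f signature \<Rightarrow> ('f, 'b) algebra \<Rightarrow> ('f, 'a) algebra \<Rightarrow> ('b \<Rightarrow> 'a) \<Rightarrow> bool" where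
  "homomorphism S B A \<phi> \<longleftrightarrow> \<phi> ` carrier B \<subseteq> carrier A \<and>
     (\<forall>f\<in>symbols S. \<forall>xs\<in>args S f (carrier B). \<phi> (oper B f xs) = oper A f (map \<phi> xs))"

definition surjective_homomorphism ::
    "'f signature \<Rightarrow> ('f, 'b) algebra \<Rightarrow> ('f, 'a) algebra \<Rightarrow> ('b \<Rightarrow> 'a) \<Rightarrow> bool" where
  "surjective_homomorphism S B A \<phi> \<longleftrightarrow>
     homomorphism S B A \<phi> \<and> \<phi> ` carrier B = carrier A"

definition rel_image :: "('b \<Rightarrow> 'a) \<Rightarrow> ('b \<times> 'b) set \<Rightarrow> ('a \<times> 'a) set" where
  "rel_image \<phi> \<theta> = {(\<phi> x, \<phi> y) | x y. (x, y) \<in> \<theta>}"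


definition blocks :: "('f, 'a) algebra \<Rightarrow> ('a \<times> 'a) set \<Rightarrow> 'a set set" where
  "blocks A T = {B. B \<subseteq> carrier A \<and> B \<times> B \<subseteq> T \<and>
     (\<forall>C. C \<subseteq> carrier A \<and> C \<times> C \<subseteq> T \<and> B \<subseteq> C \<longrightarrow> C = B)}"

definition complex_image :: "('f, 'a) algebra \<Rightarrow> 'f \<Rightarrow> 'a set list \<Rightarrow> 'a set" where
  "complex_image A f Bs = {oper A f bs | bs. list_all2 (\<in>) bs Bs}"

definition factorable_by :: "'f signature \<Rightarrow> ('f, 'a) algebra \<Rightarrow> ('a \<times> 'a) set \<Rightarrow> bool" where
  "factorable_by S A T \<longleftrightarrow>
     (\<forall>f\<in>symbols S. \<forall>Bs\<in>args S f (blocks A T).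
        \<exists>!B. B \<in> blocks A T \<and> complex_image A f Bs \<subseteq> B)"

text \<open>Only meaningful when the algebra is factorable by the tolerance.\<close>

definition quotient_algebra ::
    "('f, 'a) algebra \<Rightarrow> ('a \<times> 'a) set \<Rightarrow> ('f, 'a set) algebra" where
  "quotient_algebra A T =
     \<lparr>carrier = blocks A T,
      oper = (\<lambda>f Bs. THE B. B \<in> blocks A T \<and> complex_image A f Bs \<subseteq> B)\<rparr>"

definition tolerance_factorable :: "'f signature \<Rightarrow> ('f, 'a) algebra \<Rightarrow> bool" where
  "tolerance_factorable S A \<longleftrightarrow> (\<forall>T. tolerance S A T \<longrightarrow> factorable_by S A T)"


text \<open>A variety is given by its similarity type together with a set of identities, i.e. pairs of
  terms over countably many variables. This makes membership meaningful for
  algebras over every carrier type.\<close>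

datatype 'f trm = Var nat | Op 'f "'f trm list"

fun wf_trm :: "'f signature \<Rightarrow> 'f trm \<Rightarrow> bool" where
  "wf_trm S (Var v) \<longleftrightarrow> True"
| "wf_trm S (Op f ts) \<longleftrightarrow>
     f \<in> symbols S \<and> length ts = arity S f \<and> (\<forall>t\<in>set ts. wf_trm S t)"

fun term_val :: "('f, 'a) algebra \<Rightarrow> (nat \<Rightarrow> 'a) \<Rightarrow> 'f trm \<Rightarrow> 'a" where
  "term_val A \<rho> (Var v) = \<rho> v"
| "term_val A \<rho> (Op f ts) = oper A f (map (term_val A \<rho>) ts)"

definition identities :: "'f signature \<Rightarrow> ('f trm \<times> 'f trm) set \<Rightarrow> bool" where
  "identities S E \<longleftrightarrow> (\<forall>(s, t)\<in>E. wf_trm S s \<and> wf_trm S t)"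

definition in_variety ::
    "'f signature \<Rightarrow> ('f trm \<times> 'f trm) set \<Rightarrow> ('f, 'a) algebra \<Rightarrow> bool" where
  "in_variety S E A \<longleftrightarrow> algebra S A \<and>
     (\<forall>(s, t)\<in>E. \<forall>\<rho>. range \<rho> \<subseteq> carrier A \<longrightarrow> term_val A \<rho> s = term_val A \<rho> t)"

text \<open>Since one cannot quantify over types inside a formula, the following properties of a variety
  carry the carrier type of the members under consideration as a parameter. The usual property of a
  variety is the one required at every type.\<close>

definition variety_tolerance_factorable ::
    "'a itself \<Rightarrow> 'f signature \<Rightarrow> ('f trm \<times> 'f trm) set \<Rightarrow> bool" where
  "variety_tolerance_factorable _ S E \<longleftrightarrow>
     (\<forall>A :: ('f, 'a) algebra. in_variety S E A \<longrightarrow> tolerance_factorable S A)"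

definition variety_strongly_tolerance_factorable ::
    "'a itself \<Rightarrow> 'f signature \<Rightarrow> ('f trm \<times> 'f trm) set \<Rightarrow> bool" where
  "variety_strongly_tolerance_factorable a S E \<longleftrightarrow>
     variety_tolerance_factorable a S E \<and>
     (\<forall>(A :: ('f, 'a) algebra) T.
        in_variety S E A \<and> tolerance S A T \<longrightarrow> in_variety S E (quotient_algebra A T))"

text \<open>The second type parameter is the carrier type in which the preimage algebra is sought; the
  usual property asks for it in some type, depending on the first one.\<close>

definition tolerances_images_of_congruences ::
    "'a itself \<Rightarrow> 'b itself \<Rightarrow> 'f signature \<Rightarrow> ('f trm \<times> 'f trm) set \<Rightarrow> bool" where
  "tolerances_images_of_congruences _ _ S E \<longleftrightarrow>
     (\<forall>(A :: ('f, 'a) algebra) T. in_variety S E A \<and> tolerance S A T \<longrightarrow>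
        (\<exists>(B :: ('f, 'b) algebra) \<theta> \<phi>.
           in_variety S E B \<and> congruence S B \<theta> \<and>
           surjective_homomorphism S B A \<phi> \<and> T = rel_image \<phi> \<theta>))"

end

theory Submission
  imports Defs
begin

text \<open>The preimage of a tolerance \<open>T\<close> is the subalgebra \<open>{(x, Y). x \<in> Y}\<close> of the product
  of \<open>A\<close> and \<open>A/T\<close>. Its first projection \<open>\<phi>\<close> is onto \<open>A\<close>, and the kernel of its second
  projection is a congruence \<open>\<theta>\<close>; since two elements are related by \<open>T\<close> iff they lie in a common
  block, \<open>\<phi>\<close> maps \<open>\<theta>\<close> onto \<open>T\<close>. Operations act componentwise, so identities true in both \<open>A\<close> and
  \<open>A/T\<close> are true in the preimage.\<close>

text \<open>Zorn's lemma, applied to the sets between \<open>C\<close> and the carrier whose square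
  lies in \<open>T\<close>.\<close>

lemma sub_block_exists:
  assumes "C \<subseteq> carrier A" "C \<times> C \<subseteq> T"
  obtains B where "B \<in> blocks A T" "C \<subseteq> B"
proof -
  define P where "P = {X. C \<subseteq> X \<and> X \<subseteq> carrier A \<and> X \<times> X \<subseteq> T}"
  have "\<exists>M\<in>P. \<forall>X\<in>P. M \<subseteq> X \<longrightarrow> X = M"
  proof (rule subset_Zorn_nonempty)
    show "P \<noteq> {}"
      using assms by (auto simp: P_def)
  next
    fix \<C> assume "\<C> \<noteq> {}" and chain: "subset.chain P \<C>"
    have P: "X \<in> P" if "X \<in> \<C>" for X
      using chain that by (auto simp: subset_chain_def)
    \<comment> \<open>Comparability in the chain puts \<open>x\<close> and \<open>y\<close> into the
      larger of \<open>X\<close> and \<open>Y\<close>, whose square lies in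
      \<open>T\<close>.\<close>
    have "(x, y) \<in> T" if "X \<in> \<C>" "Y \<in> \<C>" "x \<in> X" "y \<in> Y" for x y X Y
    proof -
      have "X \<subseteq> Y \<or> Y \<subseteq> X"
        using chain that by (auto simp: subset_chain_def)
      then show ?thesis
        using P[OF that(1)] P[OF that(2)] that(3,4) by (auto simp: P_def)
    qed
    then have "\<Union>\<C> \<times> \<Union>\<C> \<subseteq> T"
      by blast
    moreover have "C \<subseteq> \<Union>\<C>" "\<Union>\<C> \<subseteq> carrier A"
      using \<open>\<C> \<noteq> {}\<close> P unfolding P_def by blast+
    ultimately show "\<Union>\<C> \<in> P"
      by (simp add: P_def)
  qed
  then obtain M where M: "M \<in> P" "\<And>X. X \<in> P \<Longrightarrow> M \<subseteq> X \<Longrightarrow> X = M"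
    by blast
  \<comment> \<open>Zorn gives maximality only among sets containing \<open>C\<close>; a set above
    \<open>M\<close> contains \<open>C\<close> anyway, so \<open>M\<close> is maximal among all sets
    with square in \<open>T\<close>.\<close>
  have "X = M" if "X \<subseteq> carrier A" "X \<times> X \<subseteq> T" "M \<subseteq> X" for X
    using M(1) M(2)[of X] that by (auto simp: P_def)
  with M(1) have "M \<in> blocks A T"
    by (simp add: P_def blocks_def)
  with M(1) that show thesis
    by (auto simp: P_def)
qed

text \<open>By reflexivity and symmetry the square of \<open>{x, y}\<close> lies in
  \<open>T\<close>, so the pair extends to a block. The converse holds because blocks have their
  square in \<open>T\<close>.\<close>

lemma tolerance_iff_common_block:
  assumes "tolerance S A T"
  shows "(x, y) \<in> T \<longleftrightarrow> (\<exists>B\<in>blocks A T. x \<in> B \<and> y \<in> B)"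
proof
  assume xy: "(x, y) \<in> T"
  have "{x, y} \<subseteq> carrier A" "{x, y} \<times> {x, y} \<subseteq> T"
    using assms xy by (auto simp: tolerance_def refl_on_def sym_def)
  then obtain B where "B \<in> blocks A T" "{x, y} \<subseteq> B"
    by (rule sub_block_exists)
  then show "\<exists>B\<in>blocks A T. x \<in> B \<and> y \<in> B"
    by auto
qed (auto simp: blocks_def)

text \<open>Factorability supplies the unique existence that gives the \<open>THE\<close> in
  \<open>quotient_algebra\<close> its meaning.\<close>

lemma quotient_oper:
  assumes "factorable_by S A T" "f \<in> symbols S" "Bs \<in> args S f (blocks A T)"
  shows "oper (quotient_algebra A T) f Bs \<in> blocks A T"
    and "complex_image A f Bs \<subseteq> oper (quotient_algebra A T) f Bs"
proof -
  have "\<exists>!B. B \<in> blocks A T \<and> complex_image A f Bs \<subseteq> B"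
    using assms by (auto simp: factorable_by_def)
  from theI'[OF this] show "oper (quotient_algebra A T) f Bs \<in> blocks A T"
    and "complex_image A f Bs \<subseteq> oper (quotient_algebra A T) f Bs"
    by (auto simp: quotient_algebra_def)
qed

definition pointed_block_algebra ::
    "('f, 'a) algebra \<Rightarrow> ('a \<times> 'a) set \<Rightarrow> ('f, 'a \<times> 'a set) algebra" where
  "pointed_block_algebra A T =
     \<lparr>carrier = {(x, Y). Y \<in> blocks A T \<and> x \<in> Y},
      oper = (\<lambda>f ps. (oper A f (map fst ps), oper (quotient_algebra A T) f (map snd ps)))\<rparr>"

lemma oper_pointed_block:
  "oper (pointed_block_algebra A T) f ps =
     (oper A f (map fst ps), oper (quotient_algebra A T) f (map snd ps))"
  by (simp add: pointed_block_algebra_def)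

definition same_block :: "('f, 'a) algebra \<Rightarrow> ('a \<times> 'a) set \<Rightarrow> (('a \<times> 'a set) \<times> ('a \<times> 'a set)) set"
  where "same_block A T =
    {(p, q). p \<in> carrier (pointed_block_algebra A T) \<and>
             q \<in> carrier (pointed_block_algebra A T) \<and> snd p = snd q}"

text \<open>Since each point lies in its block, the value at the points belongs to the complex image
  of the blocks, hence to the block that the quotient operation selects.\<close>

lemma pointed_block_oper_closed:
  assumes "factorable_by S A T" "f \<in> symbols S"
    and ps: "ps \<in> args S f (carrier (pointed_block_algebra A T))"
  shows "oper (pointed_block_algebra A T) f ps \<in> carrier (pointed_block_algebra A T)"
proof -
  have "map snd ps \<in> args S f (blocks A T)"
    using ps by (auto simp: args_def pointed_block_algebra_def)
  note quotient_oper[OF assms(1,2) this]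
  moreover have "list_all2 (\<in>) (map fst ps) (map snd ps)"
    using ps by (auto simp: args_def pointed_block_algebra_def list_all2_conv_all_nth
        dest!: subsetD[OF _ nth_mem])
  then have "oper A f (map fst ps) \<in> complex_image A f (map snd ps)"
    by (auto simp: complex_image_def)
  ultimately show ?thesis
    by (auto simp: pointed_block_algebra_def)
qed

lemma fst_image_pointed_block:
  assumes "tolerance S A T"
  shows "fst ` carrier (pointed_block_algebra A T) = carrier A"
proof
  show "fst ` carrier (pointed_block_algebra A T) \<subseteq> carrier A"
    by (auto simp: pointed_block_algebra_def blocks_def)
  show "carrier A \<subseteq> fst ` carrier (pointed_block_algebra A T)"
  proof
    fix x assume "x \<in> carrier A"
    then have "(x, x) \<in> T"
      using assms by (auto simp: tolerance_def refl_on_def)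
    then obtain B where "B \<in> blocks A T" "x \<in> B"
      using tolerance_iff_common_block[OF assms] by blast
    then show "x \<in> fst ` carrier (pointed_block_algebra A T)"
      by (auto simp: pointed_block_algebra_def image_iff)
  qed
qed

text \<open>The carrier is nonempty because \<open>fst\<close> maps it onto the nonempty carrier of
  \<open>A\<close>.\<close>

lemma algebra_pointed_block:
  assumes "algebra S A" "tolerance S A T" "factorable_by S A T"
  shows "algebra S (pointed_block_algebra A T)"
  using assms fst_image_pointed_block[OF assms(2)] pointed_block_oper_closed[OF assms(3)]
  by (auto simp: algebra_def)

lemma congruence_same_block:
  assumes "factorable_by S A T"
  shows "congruence S (pointed_block_algebra A T) (same_block A T)"
proof -
  have "equiv (carrier (pointed_block_algebra A T)) (same_block A T)"
    by (rule equivI) (auto simp: same_block_def intro!: refl_onI symI transI)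
  moreover have "compatible S (pointed_block_algebra A T) (same_block A T)"
    unfolding compatible_def
  proof (intro ballI impI)
    fix f ps qs
    assume f: "f \<in> symbols S"
      and ps: "ps \<in> args S f (carrier (pointed_block_algebra A T))"
      and qs: "qs \<in> args S f (carrier (pointed_block_algebra A T))"
      and "list_all2 (\<lambda>x y. (x, y) \<in> same_block A T) ps qs"
    \<comment> \<open>The second component of a result depends only on the second components of the
      arguments, so both results share their block.\<close>
    then have "map snd ps = map snd qs"
      by (auto simp: same_block_def list_all2_conv_all_nth intro!: nth_equalityI)
    then show "(oper (pointed_block_algebra A T) f ps, oper (pointed_block_algebra A T) f qs)
        \<in> same_block A T"
      using pointed_block_oper_closed[OF assms f ps] pointed_block_oper_closed[OF assms f qs]
      by (simp add: same_block_def oper_pointed_block)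
  qed
  ultimately show ?thesis
    by (simp add: congruence_def)
qed

lemma surjective_homomorphism_fst:
  assumes "tolerance S A T"
  shows "surjective_homomorphism S (pointed_block_algebra A T) A fst"
  using fst_image_pointed_block[OF assms]
  by (auto simp: surjective_homomorphism_def homomorphism_def oper_pointed_block)

lemma rel_image_same_block:
  assumes "tolerance S A T"
  shows "rel_image fst (same_block A T) = T"
proof -
  have "(x, y) \<in> rel_image fst (same_block A T) \<longleftrightarrow> (\<exists>B\<in>blocks A T. x \<in> B \<and> y \<in> B)" for x y
    by (force simp: rel_image_def same_block_def pointed_block_algebra_def)
  then show ?thesis
    by (auto simp: tolerance_iff_common_block[OF assms])
qed

text \<open>The operations are defined componentwise on all lists, so this holds for every
  assignment, even one leaving the carrier.\<close>

lemma term_val_pointed_block: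
  "term_val (pointed_block_algebra A T) \<rho> t =
     (term_val A (\<lambda>n. fst (\<rho> n)) t, term_val (quotient_algebra A T) (\<lambda>n. snd (\<rho> n)) t)"
proof (induction t)
  case (Op f ts)
  then show ?case
    by (simp add: oper_pointed_block comp_def cong: map_cong)
qed simp

text \<open>An assignment into the pairs projects to assignments into \<open>A\<close> and into the
  quotient, and an identity is checked in each component.\<close>

lemma in_variety_pointed_block:
  assumes A: "in_variety S E A" and Q: "in_variety S E (quotient_algebra A T)"
    and T: "tolerance S A T" "factorable_by S A T"
  shows "in_variety S E (pointed_block_algebra A T)"
proof -
  have "term_val (pointed_block_algebra A T) \<rho> s = term_val (pointed_block_algebra A T) \<rho> t"
    if "(s, t) \<in> E" and \<rho>: "range \<rho> \<subseteq> carrier (pointed_block_algebra A T)" for s t \<rho>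
  proof -
    have mem: "snd (\<rho> n) \<in> blocks A T \<and> fst (\<rho> n) \<in> snd (\<rho> n)" for n
      using subsetD[OF \<rho> rangeI, of n] by (auto simp: pointed_block_algebra_def)
    then have "range (\<lambda>n. fst (\<rho> n)) \<subseteq> carrier A"
      by (auto simp: blocks_def)
    moreover have "range (\<lambda>n. snd (\<rho> n)) \<subseteq> carrier (quotient_algebra A T)"
      using mem by (auto simp: quotient_algebra_def)
    ultimately show ?thesis
      using A Q that(1) unfolding in_variety_def term_val_pointed_block by blast
  qed
  moreover have "algebra S (pointed_block_algebra A T)"
    using A T by (auto simp: in_variety_def intro: algebra_pointed_block)
  ultimately show ?thesis
    by (auto simp: in_variety_def)
qed

theorem proposition2:
  fixes S :: "'f signature"
  shows
    "(\<forall>(A :: ('f, 'a) algebra) T.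
        algebra S A \<and> tolerance_factorable S A \<and> tolerance S A T \<longrightarrow>
        (\<exists>(B :: ('f, 'a \<times> 'a set) algebra) \<theta> \<phi>.
           algebra S B \<and> congruence S B \<theta> \<and>
           surjective_homomorphism S B A \<phi> \<and> T = rel_image \<phi> \<theta>))
     \<and>
     (\<forall>E. identities S E \<and> variety_strongly_tolerance_factorable TYPE('a) S E \<longrightarrow>
        tolerances_images_of_congruences TYPE('a) TYPE('a \<times> 'a set) S E)"
proof (intro conjI allI impI)
  fix A :: "('f, 'a) algebra" and T
  assume *: "algebra S A \<and> tolerance_factorable S A \<and> tolerance S A T"
  then have "factorable_by S A T"
    by (auto simp: tolerance_factorable_def)
  with * show "\<exists>(B :: ('f, 'a \<times> 'a set) algebra) \<theta> \<phi>.
      algebra S B \<and> congruence S B \<theta> \<and> surjective_homomorphism S B A \<phi> \<and> T = rel_image \<phi> \<theta>"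
    by (intro exI[of _ "pointed_block_algebra A T"] exI[of _ "same_block A T"] exI[of _ fst])
      (auto simp: rel_image_same_block[of S]
        intro: algebra_pointed_block congruence_same_block surjective_homomorphism_fst)
next
  fix E
  assume *: "identities S E \<and> variety_strongly_tolerance_factorable TYPE('a) S E"
  show "tolerances_images_of_congruences TYPE('a) TYPE('a \<times> 'a set) S E"
    unfolding tolerances_images_of_congruences_def
  proof (intro allI impI)
    fix A :: "('f, 'a) algebra" and T
    assume A: "in_variety S E A \<and> tolerance S A T"
    \<comment> \<open>Strong factorability enters twice: it makes the quotient operations well
      defined and keeps the quotient in the variety.\<close>
    with * have "factorable_by S A T" "in_variety S E (quotient_algebra A T)"
      by (auto simp: variety_strongly_tolerance_factorable_def variety_tolerance_factorable_def
          tolerance_factorable_def)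
    with A show "\<exists>(B :: ('f, 'a \<times> 'a set) algebra) \<theta> \<phi>.
        in_variety S E B \<and> congruence S B \<theta> \<and> surjective_homomorphism S B A \<phi> \<and>
        T = rel_image \<phi> \<theta>"
      by (intro exI[of _ "pointed_block_algebra A T"] exI[of _ "same_block A T"] exI[of _ fst])
        (auto simp: rel_image_same_block[of S]
          intro: in_variety_pointed_block congruence_same_block surjective_homomorphism_fst)
  qed
qed

end
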